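(* For all integers $n\ge 1$, $$\frac{d}{d\theta}F_{n+1}(\theta)=F_n(\theta).$$
   Context: Let $\theta\in\mathbb{R}$ and let $n\ge1$ be an integer. The polylogarithm on the unit circle is $$\mathrm{Li}_n(e^{i\theta})=\sum_{k=1}^{\infty}\frac{e^{ik\theta}}{k^n}=\sum_{k=1}^{\infty}\frac{\cos(k\theta)}{k^n}+i\sum_{k=1}^{\infty}\frac{\sin(k\theta)}{k^n}.$$ The phase-normalized master function is $F_n(\theta):=i^{-n}\,\mathrm{Li}_n(e^{i\theta})$.
   Formalization: For n = 1 the identity is stated only for θ not a multiple of 2π, because there F_1(θ) is the divergent harmonic series and F_2 is not differentiable; for n ≥ 2 it is stated for all real θ. *)

theory Defs
  imports "HOL-Analysis.Analysis"
begin

(* The sum over k >= 1 is reindexed from 0 via Suc. suminf is the limit of the partial sums in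
   their natural order, as needed for n = 1, where the series on the unit circle converges only
   conditionally. It carries meaning only where the series converges: on |z| = 1, for all z if
   n >= 2 and for z \<noteq> 1 if n = 1. *)
definition polylog :: "nat \<Rightarrow> complex \<Rightarrow> complex" where
  "polylog n z = (\<Sum>k. z ^ Suc k / of_nat (Suc k) ^ n)"

definition master_fun :: "nat \<Rightarrow> real \<Rightarrow> complex" where
  "master_fun n \<theta> = \<i> powi (- int n) * polylog n (exp (\<i> * complex_of_real \<theta>))"

end

theory Submission
  imports Defs
begin

text \<open>
  The series of \<open>Li\<^sub>n\<^sub>+\<^sub>1(e\<^sup>i\<^sup>\<theta>)\<close> is differentiated term by term. The derivative of
  \<open>e\<^sup>i\<^sup>k\<^sup>\<theta> / k\<^sup>n\<^sup>+\<^sup>1\<close> is \<open>\<i> e\<^sup>i\<^sup>k\<^sup>\<theta> / k\<^sup>n\<close>, and the phase \<open>\<i>\<^sup>-\<^sup>n\<close> in the master function is chosen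
  exactly so that this factor \<open>\<i>\<close> is absorbed. What has to be justified is the interchange of
  derivative and sum, for which it suffices that the differentiated series converges uniformly
  on a neighbourhood of \<open>\<theta>\<close>.

  For \<open>n \<ge> 2\<close> the Weierstrass test with majorant \<open>1 / k\<^sup>n\<close> gives this on the whole real line. For
  \<open>n = 1\<close> the convergence is only conditional, and it fails to be uniform near the multiples of
  \<open>2\<pi>\<close>. Away from them the geometric sums \<open>\<Sum> e\<^sup>i\<^sup>k\<^sup>\<theta>\<close> are uniformly bounded, while the
  coefficients \<open>1 / k\<close> decrease to zero, so Dirichlet's test (\<open>uniformly_convergent_on_Dirichlet\<close>)
  applies. Both cases are combined in \<open>polylog_series_locally_uniformly_convergent\<close>.
\<close>

lemma summation_by_parts:
  fixes a :: "nat \<Rightarrow> real" and b :: "nat \<Rightarrow> 'a::real_vector"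
  shows "(\<Sum>k<N. a k *\<^sub>R b k) =
    a N *\<^sub>R (\<Sum>k<N. b k) + (\<Sum>k<N. (a k - a (Suc k)) *\<^sub>R (\<Sum>j<Suc k. b j))"
proof (induction N)
  case 0
  show ?case by simp
next
  case (Suc N)
  have "(\<Sum>k<Suc N. a k *\<^sub>R b k) =
      a N *\<^sub>R (\<Sum>k<Suc N. b k) + (\<Sum>k<N. (a k - a (Suc k)) *\<^sub>R (\<Sum>j<Suc k. b j))"
    using Suc.IH by (simp add: scaleR_add_right)
  then show ?case
    by (simp add: scaleR_left_diff_distrib)
qed

text \<open>
  Dirichlet's test with a parameter. After summation by parts the boundary term is at most
  \<open>a N * C\<close>, and the remaining series is dominated by \<open>(a k - a (Suc k)) * C\<close>, which telescopes;
  neither bound depends on the parameter.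
\<close>

lemma uniformly_convergent_on_Dirichlet:
  fixes a :: "nat \<Rightarrow> real" and b :: "nat \<Rightarrow> 'x \<Rightarrow> 'a::banach"
  assumes "decseq a" and a_0: "a \<longlonglongrightarrow> 0"
    and C: "\<And>N x. x \<in> X \<Longrightarrow> norm (\<Sum>k<N. b k x) \<le> C"
  shows "uniformly_convergent_on X (\<lambda>N x. \<Sum>k<N. a k *\<^sub>R b k x)"
proof -
  have dec: "a (Suc k) \<le> a k" for k
    using \<open>decseq a\<close> by (simp add: decseq_Suc_iff)
  have nonneg: "a k \<ge> 0" for k
    using decseq_ge[OF \<open>decseq a\<close> a_0] .
  have boundary: "uniform_limit X (\<lambda>N x. a N *\<^sub>R (\<Sum>k<N. b k x)) (\<lambda>x. 0) sequentially"
  proof (rule uniform_limitI)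
    fix e :: real assume "e > 0"
    have "(\<lambda>N. a N * C) \<longlonglongrightarrow> 0"
      using tendsto_mult_left_zero[OF a_0] .
    then have "\<forall>\<^sub>F N in sequentially. a N * C < e"
      using \<open>e > 0\<close> by (rule order_tendstoD(2))
    then show "\<forall>\<^sub>F N in sequentially. \<forall>x\<in>X. dist (a N *\<^sub>R (\<Sum>k<N. b k x)) 0 < e"
    proof eventually_elim
      case (elim N)
      have "a N * norm (\<Sum>k<N. b k x) \<le> a N * C" if "x \<in> X" for x
        using C[OF that] nonneg by (rule mult_left_mono)
      with elim nonneg[of N] show ?case
        by fastforce
    qed
  qed
  have "summable (\<lambda>k. (a k - a (Suc k)) * C)"
    using telescope_summable'[OF a_0] by (rule summable_mult2)
  moreover have "norm ((a k - a (Suc k)) *\<^sub>R (\<Sum>j<Suc k. b j x)) \<le> (a k - a (Suc k)) * C"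
    if "x \<in> X" for k x
    unfolding norm_scaleR using C[OF that, of "Suc k"] dec[of k]
    by (simp add: mult_left_mono del: sum.lessThan_Suc)
  ultimately have "uniform_limit X
      (\<lambda>N x. \<Sum>k<N. (a k - a (Suc k)) *\<^sub>R (\<Sum>j<Suc k. b j x))
      (\<lambda>x. \<Sum>k. (a k - a (Suc k)) *\<^sub>R (\<Sum>j<Suc k. b j x)) sequentially"
    by (intro Weierstrass_m_test)
  from uniform_limit_add[OF boundary this] show ?thesis
    unfolding uniformly_convergent_on_def by (subst summation_by_parts) blast
qed

lemma norm_geometric_sum_le:
  fixes z :: complex
  assumes "norm z \<le> 1" and "z \<noteq> 1"
  shows "norm (\<Sum>k<N. z ^ Suc k) \<le> 2 / norm (1 - z)"
proof -
  have "(\<Sum>k<N. z ^ Suc k) = z * ((1 - z ^ N) / (1 - z))"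
    using sum_gp_strict[of z N] \<open>z \<noteq> 1\<close> by (simp add: sum_distrib_left[symmetric])
  moreover have "norm (1 - z ^ N) \<le> 2"
    using norm_triangle_ineq4[of 1 "z ^ N"] power_le_one[of "norm z" N] \<open>norm z \<le> 1\<close>
    by (simp add: norm_power)
  ultimately show ?thesis
    using mult_mono[of "norm z" 1 "norm (1 - z ^ N)" 2] \<open>norm z \<le> 1\<close>
    by (simp add: norm_mult norm_divide divide_right_mono)
qed

text \<open>
  The radius has to depend on \<open>\<theta>\<close> only for \<open>n = 1\<close>, where it keeps \<open>e\<^sup>i\<^sup>x\<close> at a distance from \<open>1\<close>
  of at least half that of \<open>e\<^sup>i\<^sup>\<theta>\<close>, so that the bound on the geometric sums is uniform in \<open>x\<close>.
\<close>

lemma polylog_series_locally_uniformly_convergent: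
  fixes n :: nat and \<theta> :: real
  assumes "n \<ge> 1" and "n = 1 \<Longrightarrow> exp (\<i> * complex_of_real \<theta>) \<noteq> 1"
  obtains e where "e > 0"
    and "uniformly_convergent_on (ball \<theta> e)
      (\<lambda>N x. \<Sum>k<N. exp (\<i> * complex_of_real x) ^ Suc k / of_nat (Suc k) ^ n)"
proof (cases "n = 1")
  case True
  define c where "c = norm (1 - exp (\<i> * complex_of_real \<theta>)) / 2"
  have "c > 0"
    using assms(2)[OF True] by (simp add: c_def)
  have "((\<lambda>x. norm (1 - exp (\<i> * complex_of_real x))) \<longlongrightarrow> 2 * c) (nhds \<theta>)"
    unfolding c_def by (auto intro!: tendsto_eq_intros filterlim_ident)
  then have "\<forall>\<^sub>F x in nhds \<theta>. c < norm (1 - exp (\<i> * complex_of_real x))"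
    by (rule order_tendstoD(1)) (use \<open>c > 0\<close> in simp)
  then obtain e where "e > 0"
    and e: "\<And>x. x \<in> ball \<theta> e \<Longrightarrow> c < norm (1 - exp (\<i> * complex_of_real x))"
    unfolding eventually_nhds_metric by (auto simp: dist_commute)
  have "norm (\<Sum>k<N. exp (\<i> * complex_of_real x) ^ Suc k) \<le> 2 / c" if "x \<in> ball \<theta> e" for N x
  proof -
    let ?z = "exp (\<i> * complex_of_real x)"
    have "?z \<noteq> 1"
      using e[OF that] \<open>c > 0\<close> by auto
    then have "norm (\<Sum>k<N. ?z ^ Suc k) \<le> 2 / norm (1 - ?z)"
      by (intro norm_geometric_sum_le) simp
    also have "\<dots> \<le> 2 / c"
      using e[OF that] \<open>c > 0\<close> by (intro divide_left_mono mult_pos_pos) auto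
    finally show ?thesis .
  qed
  then have "uniformly_convergent_on (ball \<theta> e)
      (\<lambda>N x. \<Sum>k<N. inverse (real (Suc k)) *\<^sub>R exp (\<i> * complex_of_real x) ^ Suc k)"
    by (intro uniformly_convergent_on_Dirichlet LIMSEQ_inverse_real_of_nat)
      (auto simp: decseq_Suc_iff)
  moreover have "inverse (real (Suc k)) *\<^sub>R z = z / of_nat (Suc k) ^ n" for k and z :: complex
    by (simp only: True power_one_right scaleR_conv_of_real of_real_inverse of_real_of_nat_eq
        divide_inverse mult.commute)
  ultimately show ?thesis
    using that[OF \<open>e > 0\<close>] by simp
next
  case False
  have "summable (\<lambda>k. inverse (real (Suc k) ^ n))"
    using inverse_power_summable[of n, where 'a = real] assms(1) False
    by (subst summable_Suc_iff) simp
  then have "uniformly_convergent_on (ball \<theta> 1)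
      (\<lambda>N x. \<Sum>k<N. exp (\<i> * complex_of_real x) ^ Suc k / of_nat (Suc k) ^ n)"
    by (intro Weierstrass_m_test'[where M = "\<lambda>k. inverse (real (Suc k) ^ n)"])
      (simp_all add: norm_divide norm_power norm_mult inverse_eq_divide
        del: of_nat_Suc)
  then show ?thesis
    using that[of 1] by simp
qed

lemma polylog_term_has_vector_derivative:
  "((\<lambda>x. exp (\<i> * complex_of_real x) ^ Suc k / of_nat (Suc k) ^ Suc n) has_vector_derivative
    \<i> * (exp (\<i> * complex_of_real x) ^ Suc k / of_nat (Suc k) ^ n)) (at x within S)"
proof -
  have "((\<lambda>w. exp (\<i> * w) ^ Suc k / of_nat (Suc k) ^ Suc n) has_field_derivative
      of_nat (Suc k) * (exp (\<i> * w) * \<i>) * exp (\<i> * w) ^ k / of_nat (Suc k) ^ Suc n) (at w)"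
    for w :: complex
    by (auto intro!: derivative_eq_intros simp del: of_nat_Suc power_Suc)
  moreover have "of_nat (Suc k) * (z * \<i>) * z ^ k / of_nat (Suc k) ^ Suc n =
      \<i> * (z ^ Suc k / of_nat (Suc k) ^ n)" for z :: complex
    by (simp add: field_simps del: of_nat_Suc)
  ultimately have "((\<lambda>w. exp (\<i> * w) ^ Suc k / of_nat (Suc k) ^ Suc n) has_field_derivative
      \<i> * (exp (\<i> * w) ^ Suc k / of_nat (Suc k) ^ n)) (at w)" for w :: complex
    by (simp only:)
  then show ?thesis
    by (rule has_vector_derivative_real_field)
qed

text \<open>
  Termwise differentiation needs uniform convergence of the differentiated series near \<open>\<theta>\<close>, but
  of the original series only convergence at the single point \<open>\<theta>\<close>. For \<open>n = 1\<close> the case \<open>\<theta> \<in> 2\<pi>\<int>\<close>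
  is lost because of the first of these requirements.
\<close>

lemma polylog_unit_circle_has_vector_derivative:
  fixes n :: nat and \<theta> :: real
  assumes "n \<ge> 1" and "n = 1 \<Longrightarrow> exp (\<i> * complex_of_real \<theta>) \<noteq> 1"
  shows "((\<lambda>x. polylog (Suc n) (exp (\<i> * complex_of_real x))) has_vector_derivative
    \<i> * polylog n (exp (\<i> * complex_of_real \<theta>))) (at \<theta>)"
proof -
  let ?f = "\<lambda>n k x. exp (\<i> * complex_of_real x) ^ Suc k / of_nat (Suc k) ^ n"
  let ?L = "\<lambda>n x. polylog n (exp (\<i> * complex_of_real x))"
  obtain e where "e > 0" and e: "uniformly_convergent_on (ball \<theta> e) (\<lambda>N x. \<Sum>k<N. ?f n k x)"
    using polylog_series_locally_uniformly_convergent[OF assms] by blast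
  have lim: "uniform_limit (ball \<theta> e) (\<lambda>N x. \<Sum>k<N. ?f n k x) (?L n) sequentially"
    using uniform_limit_suminf[OF e] by (simp only: polylog_def)
  have "summable (\<lambda>k. ?f (Suc n) k \<theta>)"
  proof -
    obtain d where "d > 0"
      and "uniformly_convergent_on (ball \<theta> d) (\<lambda>N x. \<Sum>k<N. ?f (Suc n) k x)"
      using polylog_series_locally_uniformly_convergent[of "Suc n" \<theta>] assms(1) by auto
    then have "convergent (\<lambda>N. \<Sum>k<N. ?f (Suc n) k \<theta>)"
      by (intro uniformly_convergent_imp_convergent[of "ball \<theta> d"]) auto
    then show ?thesis
      by (simp only: summable_iff_convergent)
  qed
  then have sums: "(\<lambda>k. ?f (Suc n) k \<theta>) sums ?L (Suc n) \<theta>"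
    by (simp only: polylog_def summable_sums)
  have "\<exists>g. \<forall>x\<in>ball \<theta> e. (\<lambda>k. ?f (Suc n) k x) sums g x \<and>
      (g has_derivative (\<lambda>h. h *\<^sub>R (\<i> * ?L n x))) (at x within ball \<theta> e)"
  proof (rule has_derivative_series)
    show "(?f (Suc n) k has_derivative (\<lambda>h. h *\<^sub>R (\<i> * ?f n k x))) (at x within ball \<theta> e)" for k x
      using polylog_term_has_vector_derivative unfolding has_vector_derivative_def .
    show "\<forall>\<^sub>F N in sequentially. \<forall>x\<in>ball \<theta> e. \<forall>h.
        norm ((\<Sum>k<N. h *\<^sub>R (\<i> * ?f n k x)) - h *\<^sub>R (\<i> * ?L n x)) \<le> d * norm h"
      if "d > 0" for d
      using uniform_limitD[OF lim that]
    proof eventually_elim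
      case (elim N)
      have "norm ((\<Sum>k<N. h *\<^sub>R (\<i> * ?f n k x)) - h *\<^sub>R (\<i> * ?L n x)) \<le> d * norm h"
        if "x \<in> ball \<theta> e" for x h
      proof -
        have "(\<Sum>k<N. h *\<^sub>R (\<i> * ?f n k x)) - h *\<^sub>R (\<i> * ?L n x) =
            h *\<^sub>R (\<i> * ((\<Sum>k<N. ?f n k x) - ?L n x))"
          by (simp only: scaleR_sum_right[symmetric] sum_distrib_left[symmetric]
              scaleR_right_diff_distrib[symmetric] right_diff_distrib[symmetric])
        then have "norm ((\<Sum>k<N. h *\<^sub>R (\<i> * ?f n k x)) - h *\<^sub>R (\<i> * ?L n x)) =
            \<bar>h\<bar> * dist (\<Sum>k<N. ?f n k x) (?L n x)"
          by (simp only: norm_scaleR norm_mult norm_ii mult_1 dist_norm)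
        also have "\<dots> \<le> \<bar>h\<bar> * d"
          using bspec[OF elim that] by (intro mult_left_mono less_imp_le abs_ge_zero)
        finally show ?thesis
          by (simp only: real_norm_def mult.commute)
      qed
      then show ?case by blast
    qed
  qed (use \<open>e > 0\<close> sums in auto)
  then obtain g where g: "\<And>x. x \<in> ball \<theta> e \<Longrightarrow> (\<lambda>k. ?f (Suc n) k x) sums g x"
    and g': "\<And>x. x \<in> ball \<theta> e \<Longrightarrow>
      (g has_derivative (\<lambda>h. h *\<^sub>R (\<i> * ?L n x))) (at x within ball \<theta> e)"
    by blast
  have "(g has_vector_derivative \<i> * ?L n \<theta>) (at \<theta>)"
    using g'[of \<theta>] \<open>e > 0\<close> at_within_open[of \<theta> "ball \<theta> e"]
    by (simp add: has_vector_derivative_def)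
  moreover have "g x = ?L (Suc n) x" if "x \<in> ball \<theta> e" for x
    unfolding polylog_def using g[OF that] by (rule sums_unique)
  ultimately show ?thesis
    using centre_in_ball[of \<theta> e] \<open>e > 0\<close>
    by (blast intro: has_vector_derivative_transform_within_open[where S = "ball \<theta> e"])
qed

theorem proposition2p1:
  fixes n :: nat and \<theta> :: real
  assumes "n \<ge> 1"
    and "n = 1 \<Longrightarrow> exp (\<i> * complex_of_real \<theta>) \<noteq> 1"
  shows "(master_fun (n + 1) has_vector_derivative master_fun n \<theta>) (at \<theta>)"
proof -
  have phase: "\<i> powi (- int (Suc n)) * \<i> = \<i> powi (- int n)"
    using power_int_add_1[of \<i> "- int (Suc n)"] by simp
  have "((\<lambda>x. \<i> powi (- int (Suc n)) * polylog (Suc n) (exp (\<i> * complex_of_real x)))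
      has_vector_derivative
      \<i> powi (- int (Suc n)) * (\<i> * polylog n (exp (\<i> * complex_of_real \<theta>)))) (at \<theta>)"
    using polylog_unit_circle_has_vector_derivative[OF assms]
    by (rule has_vector_derivative_mult_right)
  then show ?thesis
    by (simp only: master_fun_def[abs_def] Suc_eq_plus1[symmetric] mult.assoc[symmetric] phase)
qed

end
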